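(* Let $G$ be a graph. Then $\alpha(G) \ge \Omega(G)$ and $\omega(G) \ge \varphi(G)$.
   Context: Graphs are finite and simple with nonempty vertex set; $n = |V(G)|$ and $\deg(v)$ is the degree of $v$ in $G$. A set $A \subseteq V(G)$ is small if $\deg(v) \le n - |A|$ for every $v \in A$. A set $B \subseteq V(G)$ is large if $\deg(v) \ge |B| - 1$ for every $v \in B$. $\varphi(G)$ is the minimum integer $t$ such that $V(G)$ can be partitioned into $t$ small sets, and $\Omega(G)$ is the minimum integer $t$ such that $V(G)$ can be partitioned into $t$ large sets. $\alpha(G)$ is the independence number and $\omega(G)$ the clique number of $G$. *)

theory Defs
  imports "Graph_Theory.Digraph" "HOL-Library.Disjoint_Sets"
begin

text \<open>
  Finite simple graphs are the locale \<open>graph\<close>: finite, loop-free, symmetric digraphs without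
  multiple arcs. An undirected edge \<open>uv\<close> is the pair of arcs from \<open>u\<close> to \<open>v\<close> and from
  \<open>v\<close> to \<open>u\<close>, so adjacency is \<^const>\<open>dominates\<close> and the degree of a vertex is its
  \<^const>\<open>out_degree\<close>.
\<close>

abbreviation degree :: "('a, 'b) pre_digraph \<Rightarrow> 'a \<Rightarrow> nat" where
  "degree G v \<equiv> out_degree G v"

text \<open>
  Neither subtraction of natural numbers below truncates when \<open>G\<close> is finite: \<open>A\<close> is a subset
  of the vertex set, and \<open>B\<close> contains \<open>v\<close>.
\<close>

definition small :: "('a, 'b) pre_digraph \<Rightarrow> 'a set \<Rightarrow> bool" where
  "small G A \<longleftrightarrow> A \<subseteq> verts G \<and> (\<forall>v\<in>A. degree G v \<le> card (verts G) - card A)"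

definition large :: "('a, 'b) pre_digraph \<Rightarrow> 'a set \<Rightarrow> bool" where
  "large G B \<longleftrightarrow> B \<subseteq> verts G \<and> (\<forall>v\<in>B. degree G v \<ge> card B - 1)"

text \<open>
  The parts of a \<^const>\<open>partition_on\<close> are nonempty. Both minima exist for a finite simple
  graph, since every singleton is small and large.
\<close>

definition small_partition_number :: "('a, 'b) pre_digraph \<Rightarrow> nat" (\<open>\<phi>\<close>) where
  "\<phi> G = (LEAST t. \<exists>P. partition_on (verts G) P \<and> card P = t \<and> (\<forall>A\<in>P. small G A))"

definition large_partition_number :: "('a, 'b) pre_digraph \<Rightarrow> nat" (\<open>\<Omega>\<close>) where
  "\<Omega> G = (LEAST t. \<exists>P. partition_on (verts G) P \<and> card P = t \<and> (\<forall>B\<in>P. large G B))"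

definition independent_set :: "('a, 'b) pre_digraph \<Rightarrow> 'a set \<Rightarrow> bool" where
  "independent_set G S \<longleftrightarrow> S \<subseteq> verts G \<and> (\<forall>u\<in>S. \<forall>v\<in>S. \<not> u \<rightarrow>\<^bsub>G\<^esub> v)"

definition clique :: "('a, 'b) pre_digraph \<Rightarrow> 'a set \<Rightarrow> bool" where
  "clique G S \<longleftrightarrow> S \<subseteq> verts G \<and> (\<forall>u\<in>S. \<forall>v\<in>S. u \<noteq> v \<longrightarrow> u \<rightarrow>\<^bsub>G\<^esub> v)"

definition independence_number :: "('a, 'b) pre_digraph \<Rightarrow> nat" (\<open>\<alpha>\<close>) where
  "\<alpha> G = Max {card S | S. independent_set G S}"

definition clique_number :: "('a, 'b) pre_digraph \<Rightarrow> nat" (\<open>\<omega>\<close>) where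
  "\<omega> G = Max {card S | S. clique G S}"

end

theory Submission
  imports Defs
begin

text \<open>
  Choose greedily a vertex \<open>u\<close> of least degree among the remaining vertices and remove it together
  with its remaining neighbours. The removed set has at most \<open>deg u + 1\<close> elements, all of degree at
  least \<open>deg u\<close>, so it is large, while the chosen vertices form an independent set with exactly one
  element in each removed set. For small sets, choose instead a vertex of greatest degree and remove
  it together with the remaining non-neighbours.
\<close>

text \<open>Both greedy choices are instances: \<open>r\<close> is adjacency with \<open>f\<close>
  the degree, or non-adjacency with \<open>f\<close> the number of vertices minus the degree.
  Non-adjacency is reflexive in a loop-free graph, so equal vertices are treated separately.\<close>

lemma greedy_partition:
  fixes f :: "'a \<Rightarrow> nat" and r :: "'a \<Rightarrow> 'a \<Rightarrow> bool"
  assumes "finite U" and "\<And>u v. u \<in> U \<Longrightarrow> v \<in> U \<Longrightarrow> r u v \<Longrightarrow> r v u"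
  obtains S P where "S \<subseteq> U" "\<forall>u\<in>S. \<forall>v\<in>S. u \<noteq> v \<longrightarrow> \<not> r u v"
    and "partition_on U P" "card P = card S"
      "\<forall>B\<in>P. \<exists>u\<in>B. \<forall>v\<in>B. f u \<le> f v \<and> (v = u \<or> r u v)"
proof -
  have "\<exists>S P. S \<subseteq> U \<and> partition_on U P \<and> card P = card S
    \<and> (\<forall>u\<in>S. \<forall>v\<in>S. u \<noteq> v \<longrightarrow> \<not> r u v)
    \<and> (\<forall>B\<in>P. \<exists>u\<in>B. \<forall>v\<in>B. f u \<le> f v \<and> (v = u \<or> r u v))"
    using assms
  proof (induction U rule: finite_psubset_induct)
    case (psubset U)
    show ?case
    proof (cases "U = {}")
      case True
      then show ?thesis
        by (auto simp: partition_on_def)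
    next
      case False
      then obtain u where u: "u \<in> U" "\<And>v. v \<in> U \<Longrightarrow> f u \<le> f v"
        using ex_min_if_finite[of "f ` U"] psubset.hyps by (force simp: not_less)
      \<comment> \<open>The disjunct \<open>v = u\<close> puts \<open>u\<close> into
        \<open>B\<close> even when \<open>r u u\<close> fails, so \<open>U - B\<close> is strictly
        smaller.\<close>
      define B where "B = {v \<in> U. v = u \<or> r u v}"
      have "U - B \<subset> U" and "B \<subseteq> U" and "u \<in> B"
        using u by (auto simp: B_def)
      have "\<exists>S P. S \<subseteq> U - B \<and> partition_on (U - B) P \<and> card P = card S
        \<and> (\<forall>u\<in>S. \<forall>v\<in>S. u \<noteq> v \<longrightarrow> \<not> r u v)
        \<and> (\<forall>B\<in>P. \<exists>u\<in>B. \<forall>v\<in>B. f u \<le> f v \<and> (v = u \<or> r u v))"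
        by (rule psubset.IH[OF \<open>U - B \<subset> U\<close>]) (use psubset.prems in blast)
      then obtain S P where S: "S \<subseteq> U - B" "\<forall>u\<in>S. \<forall>v\<in>S. u \<noteq> v \<longrightarrow> \<not> r u v"
        and P: "partition_on (U - B) P" "card P = card S"
          "\<forall>B\<in>P. \<exists>u\<in>B. \<forall>v\<in>B. f u \<le> f v \<and> (v = u \<or> r u v)"
        by blast
      have "finite P" "finite S"
        using P(1) S(1) psubset.hyps by (auto intro: finite_elements finite_subset)
      moreover have "B \<notin> P"
        using P(1) \<open>u \<in> B\<close> by (auto simp: partition_on_def)
      moreover have "u \<notin> S"
        using S(1) \<open>u \<in> B\<close> by blast
      ultimately have "card (insert B P) = card (insert u S)"
        using P(2) by simp
      moreover have "partition_on U (insert B P)"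
        using P(1) \<open>B \<subseteq> U\<close> \<open>u \<in> B\<close>
        by (auto simp: partition_on_def disjoint_def)
      moreover have "insert u S \<subseteq> U"
        using S(1) u(1) by blast
      moreover have "\<forall>x\<in>insert u S. \<forall>y\<in>insert u S. x \<noteq> y \<longrightarrow> \<not> r x y"
      proof -
        \<comment> \<open>Later choices lie outside \<open>B\<close>, which excludes
          \<open>r u y\<close>; symmetry of \<open>r\<close> then excludes
          \<open>r y u\<close>.\<close>
        have "\<not> r u y" "\<not> r y u" if "y \<in> S" for y
          using that S(1) u(1) psubset.prems[of y u] by (auto simp: B_def)
        then show ?thesis
          using S(2) by blast
      qed
      moreover have "\<forall>C\<in>insert B P. \<exists>x\<in>C. \<forall>y\<in>C. f x \<le> f y \<and> (y = x \<or> r x y)"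
      proof -
        have "\<forall>y\<in>B. f u \<le> f y \<and> (y = u \<or> r u y)"
          using u(2) by (simp add: B_def)
        then show ?thesis
          using P(3) \<open>u \<in> B\<close> by blast
      qed
      ultimately show ?thesis
        by blast
    qed
  qed
  then show thesis
    using that by blast
qed

lemma (in fin_digraph) finite_dominated: "finite {v. u \<rightarrow>\<^bsub>G\<^esub> v}"
  by (rule finite_subset[OF _ finite_verts]) auto

text \<open>Without parallel arcs, \<open>head G\<close> is injective on the arcs leaving
  \<open>u\<close>, so counting arcs counts neighbours.\<close>

lemma (in nomulti_digraph) out_degree_eq_card_dominated:
  "out_degree G u = card {v. u \<rightarrow>\<^bsub>G\<^esub> v}"
proof -
  have "inj_on (head G) (out_arcs G u)"
    by (auto simp: inj_on_def intro!: no_multi_arcs simp: arc_to_ends_def)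
  moreover have "head G ` out_arcs G u = {v. u \<rightarrow>\<^bsub>G\<^esub> v}"
    by (force simp: arcs_ends_def arc_to_ends_def)
  ultimately show ?thesis
    by (metis card_image out_degree_def)
qed

lemma (in graph) large_partition_number_le_independence_number: "\<Omega> G \<le> \<alpha> G"
proof -
  obtain S P where S: "S \<subseteq> verts G" "\<forall>u\<in>S. \<forall>v\<in>S. u \<noteq> v \<longrightarrow> \<not> u \<rightarrow>\<^bsub>G\<^esub> v"
    and P: "partition_on (verts G) P" "card P = card S"
      "\<forall>B\<in>P. \<exists>u\<in>B. \<forall>v\<in>B. degree G u \<le> degree G v \<and> (v = u \<or> u \<rightarrow>\<^bsub>G\<^esub> v)"
    by (rule greedy_partition[OF finite_verts arcs_ends_symmetric[OF sym_arcs]])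
  have "large G B" if B: "B \<in> P" for B
  proof -
    obtain u where u: "\<forall>v\<in>B. degree G u \<le> degree G v" "B \<subseteq> insert u {v. u \<rightarrow>\<^bsub>G\<^esub> v}"
      using bspec[OF P(3) B] by blast
    \<comment> \<open>\<open>B\<close> lies in the closed neighbourhood of \<open>u\<close>; the
      successor accounts for \<open>u\<close> itself and matches the \<open>- 1\<close> in
      \<open>large\<close>.\<close>
    have "card B \<le> Suc (degree G u)"
      unfolding out_degree_eq_card_dominated
      using u(2) finite_dominated[of u] card_mono[of "insert u {v. u \<rightarrow>\<^bsub>G\<^esub> v}" B]
      by (simp add: card_insert_if split: if_splits)
    then have "\<forall>v\<in>B. card B - 1 \<le> degree G v"
      using u(1) by (auto intro!: order_trans[of "card B - 1" "degree G u"])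
    moreover have "B \<subseteq> verts G"
      using P(1) B by (auto simp: partition_on_def)
    ultimately show ?thesis
      by (simp add: large_def)
  qed
  then have "\<Omega> G \<le> card S"
    unfolding large_partition_number_def by (intro Least_le) (use P in blast)
  \<comment> \<open>\<open>independent_set\<close> also ranges over equal vertices; that case is the
    absence of loops.\<close>
  moreover have "independent_set G S"
    unfolding independent_set_def using S adj_not_same by metis
  then have "card S \<le> \<alpha> G"
    unfolding independence_number_def
    by (intro Max_ge finite_subset[OF _ finite_imageI[OF finite_Pow_iff[THEN iffD2, OF finite_verts]]])
      (auto simp: independent_set_def)
  ultimately show ?thesis
    by simp
qed

lemma (in graph) small_partition_number_le_clique_number: "\<phi> G \<le> \<omega> G"
proof -
  \<comment> \<open>This bound keeps the subtractions below from truncating, so that inequalities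
    between them can be rearranged.\<close>
  have deg_le: "degree G u \<le> card (verts G)" for u
    unfolding out_degree_eq_card_dominated by (rule card_mono) auto
  have nonadj_sym: "\<not> v \<rightarrow>\<^bsub>G\<^esub> u" if "\<not> u \<rightarrow>\<^bsub>G\<^esub> v" for u v
    using that arcs_ends_symmetric[OF sym_arcs] by blast
  \<comment> \<open>With \<open>r\<close> as non-adjacency, the chosen vertices are pairwise
    adjacent. Minimising the complementary value \<open>card (verts G) - degree G u\<close> selects
    a vertex of greatest degree.\<close>
  obtain S P where S: "S \<subseteq> verts G" "\<forall>u\<in>S. \<forall>v\<in>S. u \<noteq> v \<longrightarrow> \<not> \<not> u \<rightarrow>\<^bsub>G\<^esub> v"
    and P: "partition_on (verts G) P" "card P = card S"
      "\<forall>A\<in>P. \<exists>u\<in>A. \<forall>v\<in>A. card (verts G) - degree G u \<le> card (verts G) - degree G v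
        \<and> (v = u \<or> \<not> u \<rightarrow>\<^bsub>G\<^esub> v)"
    by (rule greedy_partition[OF finite_verts nonadj_sym])
  have "small G A" if AP: "A \<in> P" for A
  proof -
    have A: "A \<subseteq> verts G"
      using P(1) AP by (auto simp: partition_on_def)
    obtain u where u: "\<forall>v\<in>A. card (verts G) - degree G u \<le> card (verts G) - degree G v"
      "\<forall>v\<in>A. v = u \<or> \<not> u \<rightarrow>\<^bsub>G\<^esub> v"
      using bspec[OF P(3) AP] by blast
    \<comment> \<open>The vertex \<open>u\<close> itself survives the removal of its neighbours
      because there are no loops.\<close>
    have "A \<subseteq> verts G - {v. u \<rightarrow>\<^bsub>G\<^esub> v}"
      using A u(2) by (auto dest: adj_not_same)
    then have "card A \<le> card (verts G - {v. u \<rightarrow>\<^bsub>G\<^esub> v})"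
      by (intro card_mono) auto
    also have "\<dots> = card (verts G) - degree G u"
      unfolding out_degree_eq_card_dominated
      by (rule card_Diff_subset[OF finite_dominated]) auto
    \<comment> \<open>The chain \<open>card A \<le> card (verts G) - degree G u \<le> card (verts G)
      - degree G v\<close> lets \<open>card A\<close> and \<open>degree G v\<close> trade
      places.\<close>
    finally have "degree G v \<le> card (verts G) - card A" if "v \<in> A" for v
      using bspec[OF u(1) that] deg_le[of v] by linarith
    then show ?thesis
      using A by (simp add: small_def)
  qed
  then have "\<phi> G \<le> card S"
    unfolding small_partition_number_def by (intro Least_le) (use P in blast)
  moreover have "clique G S"
    using S by (auto simp: clique_def)
  then have "card S \<le> \<omega> G"
    unfolding clique_number_def
    by (intro Max_ge finite_subset[OF _ finite_imageI[OF finite_Pow_iff[THEN iffD2, OF finite_verts]]])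
      (auto simp: clique_def)
  ultimately show ?thesis
    by simp
qed

theorem theorem2p1:
  fixes G :: "('a, 'b) pre_digraph"
  assumes "graph G" and "verts G \<noteq> {}"
  shows "\<alpha> G \<ge> \<Omega> G \<and> \<omega> G \<ge> \<phi> G"
  using graph.large_partition_number_le_independence_number[OF assms(1)]
    graph.small_partition_number_le_clique_number[OF assms(1)]
  by blast

end
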